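(* Let $n\ge 2$ and let $M=[m_{ij}]\in\mathbb{R}^{n\times n}$ be a $B$-matrix, written as $M=B^{+}+C$ with $B^{+}=[b_{ij}]$, $b_{ij}=m_{ij}-r_i^{+}$, and $r_i^{+}=\max\left(\{0\}\cup\{m_{ij}: j\neq i\}\right)$. Let $$\beta=\min_{1\le i\le n}\Big\{b_{ii}-\sum_{j\ne i}|b_{ij}|\Big\},\quad \bar{\beta}_i=b_{ii}-\sum_{j=i+1}^{n}|b_{ij}|\,l_i(B^{+}),\quad \widehat{\beta}_i=b_{ii}-\sum_{k=i+1}^{n}|b_{ik}|\,\tilde{m}_{ki}(B^{+}),$$ with $l_i(B^+)$ and $\tilde m_{ki}(B^+)$ as defined in the context, and let $$\alpha=1+\sum_{i=2}^{n}\prod_{j=1}^{i-1}\frac{b_{jj}}{\bar{\beta}_j},\qquad \widehat{\beta}=\min_{1\le i\le n}\widehat{\beta}_i.$$ If one of the following conditions holds: (i) $\widehat{\beta}>1$ and $\alpha<\frac{1}{\beta}$; (ii) $\widehat{\beta}<1$ and $\alpha\beta<\widehat{\beta}$, then $$\sum_{i=1}^{n}\frac{n-1}{\min\{\widehat{\beta}_i,1\}}\prod_{j=1}^{i-1}\frac{b_{jj}}{\bar{\beta}_j}<\frac{n-1}{\min\{\beta,1\}},$$ where the product equals $1$ when $i=1$.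
   Context: Let $N=\{1,\dots,n\}$. A matrix $M=[m_{ij}]\in\mathbb{R}^{n\times n}$ is a $B$-matrix if for each $i\in N$: $\sum_{k\in N}m_{ik}>0$ and $\frac1n\sum_{k\in N}m_{ik}>m_{ij}$ for every $j\in N$ with $j\ne i$. In the decomposition $M=B^{+}+C$, the matrix $C$ has all entries of row $i$ equal to $r_i^{+}$. For a $B$-matrix, $B^+$ is strictly diagonally dominant by rows with positive diagonal entries. Define, for $k\in N$, $$l_k(B^{+})=\max_{k\le i\le n}\left\{\frac{1}{|b_{ii}|}\sum_{\substack{j=k\\ j\ne i}}^{n}|b_{ij}|\right\},$$ and, for $i\ne j$, $$\tilde m_{ij}(B^{+})=\frac{1}{b_{ii}}\left(|b_{ij}|+\sum_{\substack{k=j+1\\ k\ne i}}^{n}|b_{ik}|\cdot\max_{h\ne k}\left\{\frac{|b_{kh}|}{b_{kk}-\sum_{\substack{l=h+1\\ l\ne k}}^{n}|b_{kl}|}\right\}\right).$$ Empty sums are $0$. *)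

theory Defs
  imports "Jordan_Normal_Form.Matrix"
begin

text \<open>
  Matrices are indexed from 0: the index set of an n x n matrix is
  {0..<n}, so the index i of a displayed formula over {1,...,n} is i - 1 here.
\<close>

definition B_matrix :: "real mat \<Rightarrow> bool" where
  "B_matrix M \<longleftrightarrow> square_mat M \<and>
     (\<forall>i < dim_row M.
        (\<Sum>k<dim_row M. M $$ (i, k)) > 0 \<and>
        (\<forall>j < dim_row M. j \<noteq> i \<longrightarrow>
           1 / real (dim_row M) * (\<Sum>k<dim_row M. M $$ (i, k)) > M $$ (i, j)))"

definition r_plus :: "real mat \<Rightarrow> nat \<Rightarrow> real" where
  "r_plus M i = Max ({0} \<union> {M $$ (i, j) | j. j < dim_col M \<and> j \<noteq> i})"

definition B_plus :: "real mat \<Rightarrow> real mat" where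
  "B_plus M = mat (dim_row M) (dim_col M) (\<lambda>(i, j). M $$ (i, j) - r_plus M i)"

definition C_part :: "real mat \<Rightarrow> real mat" where
  "C_part M = mat (dim_row M) (dim_col M) (\<lambda>(i, j). r_plus M i)"

lemma B_plus_decomposition: "M = B_plus M + C_part M"
  by (rule eq_matI) (auto simp: B_plus_def C_part_def)

definition l_coeff :: "real mat \<Rightarrow> nat \<Rightarrow> real" where
  "l_coeff B k =
     (MAX i\<in>{k..<dim_row B}.
        1 / \<bar>B $$ (i, i)\<bar> * (\<Sum>j\<in>{k..<dim_row B} - {i}. \<bar>B $$ (i, j)\<bar>))"

definition m_tilde :: "real mat \<Rightarrow> nat \<Rightarrow> nat \<Rightarrow> real" where
  "m_tilde B i j =
     1 / B $$ (i, i) *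
       (\<bar>B $$ (i, j)\<bar> +
        (\<Sum>k\<in>{j+1..<dim_row B} - {i}.
           \<bar>B $$ (i, k)\<bar> *
           (MAX h\<in>{0..<dim_row B} - {k}.
              \<bar>B $$ (k, h)\<bar> /
              (B $$ (k, k) - (\<Sum>l\<in>{h+1..<dim_row B} - {k}. \<bar>B $$ (k, l)\<bar>)))))"

definition beta :: "real mat \<Rightarrow> real" where
  "beta B =
     (MIN i\<in>{0..<dim_row B}.
        B $$ (i, i) - (\<Sum>j\<in>{0..<dim_row B} - {i}. \<bar>B $$ (i, j)\<bar>))"

definition beta_bar :: "real mat \<Rightarrow> nat \<Rightarrow> real" where
  "beta_bar B i =
     B $$ (i, i) - (\<Sum>j\<in>{i+1..<dim_row B}. \<bar>B $$ (i, j)\<bar> * l_coeff B i)"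

definition beta_hat :: "real mat \<Rightarrow> nat \<Rightarrow> real" where
  "beta_hat B i =
     B $$ (i, i) - (\<Sum>k\<in>{i+1..<dim_row B}. \<bar>B $$ (i, k)\<bar> * m_tilde B k i)"

definition beta_hat_min :: "real mat \<Rightarrow> real" where
  "beta_hat_min B = (MIN i\<in>{0..<dim_row B}. beta_hat B i)"

definition alpha :: "real mat \<Rightarrow> real" where
  "alpha B =
     1 + (\<Sum>i\<in>{1..<dim_row B}. \<Prod>j\<in>{0..<i}. B $$ (j, j) / beta_bar B j)"

end

theory Submission imports Defs begin

text \<open>
  Write \<open>P\<^sub>i\<close> for the product of the ratios \<open>b\<^sub>j\<^sub>j / \<beta>bar\<^sub>j\<close> over \<open>j < i\<close>. The number \<open>\<alpha>\<close> is the
  sum of all \<open>P\<^sub>i\<close>, so replacing every denominator \<open>min {\<beta>hat\<^sub>i, 1}\<close> by the common lower bound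
  \<open>min {\<beta>hat, 1}\<close> bounds the left-hand side by \<open>(n - 1) \<alpha> / min {\<beta>hat, 1}\<close>, as long as this lower
  bound and the \<open>P\<^sub>i\<close> are positive. For \<open>\<beta> > 0\<close>, both alternatives imply
  \<open>\<alpha> \<beta> < min {\<beta>hat, 1}\<close>, which gives the required inequality with \<open>\<beta>\<close> in place of \<open>min {\<beta>, 1}\<close>.
  Since \<open>\<alpha> \<ge> 1\<close>, it also gives \<open>\<beta> < min {\<beta>hat, 1}\<close>: hence \<open>min {\<beta>, 1} = \<beta>\<close>, and the
  lower bound \<open>min {\<beta>hat, 1}\<close> is positive as soon as \<open>\<beta>\<close> is.

  The rest is positivity. The row sums of \<open>B\<^sup>+\<close> are positive and its off-diagonal entries are
  nonpositive, so \<open>\<beta>\<close> is a minimum of row sums and hence positive (\<open>beta_B_plus_pos\<close>). Positivity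
  of \<open>\<beta>\<close> is strict diagonal dominance, which forces \<open>l\<^sub>i \<le> 1\<close> and with it \<open>\<beta>bar\<^sub>i > 0\<close>
  (\<open>beta_bar_pos\<close>).
\<close>

lemma beta_pos_iff:
  assumes "dim_row B > 0"
  shows "beta B > 0 \<longleftrightarrow>
    (\<forall>i<dim_row B. (\<Sum>j\<in>{0..<dim_row B} - {i}. \<bar>B $$ (i, j)\<bar>) < B $$ (i, i))"
  using assms unfolding beta_def by (subst Min_gr_iff) auto

lemma r_plus_ge:
  assumes "j < dim_col M" "j \<noteq> i"
  shows "M $$ (i, j) \<le> r_plus M i"
  unfolding r_plus_def using assms by (intro Max_ge) auto

lemma r_plus_less_iff:
  "r_plus M i < c \<longleftrightarrow> 0 < c \<and> (\<forall>j<dim_col M. j \<noteq> i \<longrightarrow> M $$ (i, j) < c)"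
  unfolding r_plus_def by (subst Max_less_iff) auto

text \<open>
  The defining inequalities of a B-matrix say that the mean of each row exceeds \<open>0\<close> and every
  off-diagonal entry of that row, that is, exceeds \<open>r\<^sub>i\<^sup>+\<close>. Subtracting \<open>r\<^sub>i\<^sup>+\<close> leaves a row with
  positive sum.
\<close>

lemma B_plus_row_sum_pos:
  assumes "B_matrix M" "i < dim_row M"
  shows "(\<Sum>j<dim_row M. B_plus M $$ (i, j)) > 0"
proof -
  have dim: "dim_col M = dim_row M"
    using assms(1) by (simp add: B_matrix_def)
  have "r_plus M i < 1 / real (dim_row M) * (\<Sum>k<dim_row M. M $$ (i, k))"
    using assms dim unfolding r_plus_less_iff B_matrix_def by auto
  then have "real (dim_row M) * r_plus M i < (\<Sum>k<dim_row M. M $$ (i, k))"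
    using assms(2) by (simp add: field_simps)
  then show ?thesis
    using assms(2) dim by (simp add: B_plus_def sum_subtractf)
qed

text \<open>
  The off-diagonal entries of \<open>B\<^sup>+\<close> are nonpositive, so the dominance gap of a row, which \<open>\<beta>\<close>
  minimises, is the sum of the row.
\<close>

lemma beta_B_plus_pos:
  assumes "B_matrix M" "dim_row M > 0"
  shows "beta (B_plus M) > 0"
proof -
  let ?B = "B_plus M" and ?n = "dim_row M"
  have dim: "dim_col M = ?n" "dim_row ?B = ?n"
    using assms(1) by (simp_all add: B_matrix_def B_plus_def)
  have "(\<Sum>j\<in>{0..<?n} - {i}. \<bar>?B $$ (i, j)\<bar>) < ?B $$ (i, i)" if i: "i < ?n" for i
  proof -
    have "\<bar>?B $$ (i, j)\<bar> = - ?B $$ (i, j)" if "j \<in> {0..<?n} - {i}" for j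
      using r_plus_ge[of j M i] that i dim by (auto simp: B_plus_def)
    then have "(\<Sum>j\<in>{0..<?n} - {i}. \<bar>?B $$ (i, j)\<bar>) = - (\<Sum>j\<in>{0..<?n} - {i}. ?B $$ (i, j))"
      by (simp add: sum_negf)
    moreover have "(\<Sum>j<?n. ?B $$ (i, j)) = ?B $$ (i, i) + (\<Sum>j\<in>{0..<?n} - {i}. ?B $$ (i, j))"
      unfolding lessThan_atLeast0 using i by (intro sum.remove) auto
    ultimately show ?thesis
      using B_plus_row_sum_pos[OF assms(1) i] by linarith
  qed
  then show ?thesis
    using assms(2) dim by (subst beta_pos_iff) auto
qed

text \<open>
  Each of the quotients maximised by \<open>l\<^sub>k\<close> compares part of an off-diagonal row sum with the
  dominating diagonal entry.
\<close>

lemma l_coeff_le_1: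
  assumes "beta B > 0" "k < dim_row B"
  shows "l_coeff B k \<le> 1"
proof -
  have "1 / \<bar>B $$ (i, i)\<bar> * (\<Sum>j\<in>{k..<dim_row B} - {i}. \<bar>B $$ (i, j)\<bar>) \<le> 1"
    if "i \<in> {k..<dim_row B}" for i
  proof -
    have "(\<Sum>j\<in>{k..<dim_row B} - {i}. \<bar>B $$ (i, j)\<bar>)
        \<le> (\<Sum>j\<in>{0..<dim_row B} - {i}. \<bar>B $$ (i, j)\<bar>)"
      by (intro sum_mono2) auto
    also have "\<dots> < B $$ (i, i)"
      using assms that beta_pos_iff[of B] by auto
    finally show ?thesis
      by (simp add: divide_le_eq abs_if)
  qed
  then show ?thesis
    unfolding l_coeff_def using assms(2) by (subst Max_le_iff) auto
qed

lemma beta_bar_pos: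
  assumes "beta B > 0" "i < dim_row B"
  shows "beta_bar B i > 0"
proof -
  have "(\<Sum>j\<in>{i+1..<dim_row B}. \<bar>B $$ (i, j)\<bar> * l_coeff B i)
      \<le> (\<Sum>j\<in>{i+1..<dim_row B}. \<bar>B $$ (i, j)\<bar>)"
    using l_coeff_le_1[OF assms] by (intro sum_mono) (simp add: mult_left_le)
  also have "\<dots> \<le> (\<Sum>j\<in>{0..<dim_row B} - {i}. \<bar>B $$ (i, j)\<bar>)"
    by (intro sum_mono2) auto
  also have "\<dots> < B $$ (i, i)"
    using assms beta_pos_iff[of B] by auto
  finally show ?thesis
    by (simp add: beta_bar_def)
qed

lemma diag_pos:
  assumes "beta B > 0" "i < dim_row B"
  shows "B $$ (i, i) > 0"
proof -
  have "0 \<le> (\<Sum>j\<in>{0..<dim_row B} - {i}. \<bar>B $$ (i, j)\<bar>)"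
    by (intro sum_nonneg) auto
  also have "\<dots> < B $$ (i, i)"
    using assms beta_pos_iff[of B] by auto
  finally show ?thesis .
qed

lemma prod_diag_over_beta_bar_pos:
  assumes "beta B > 0" "i \<le> dim_row B"
  shows "(\<Prod>j\<in>{0..<i}. B $$ (j, j) / beta_bar B j) > 0"
  using assms by (intro prod_pos) (simp add: diag_pos beta_bar_pos)

text \<open>The leading \<open>1\<close> in \<open>\<alpha>\<close> is the empty product.\<close>

lemma alpha_eq_sum_prod:
  assumes "dim_row B > 0"
  shows "alpha B = (\<Sum>i\<in>{0..<dim_row B}. \<Prod>j\<in>{0..<i}. B $$ (j, j) / beta_bar B j)"
  using assms by (simp add: alpha_def sum.atLeast_Suc_lessThan)

lemma alpha_ge_1:
  assumes "beta B > 0"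
  shows "alpha B \<ge> 1"
proof -
  have "0 \<le> (\<Sum>i\<in>{1..<dim_row B}. \<Prod>j\<in>{0..<i}. B $$ (j, j) / beta_bar B j)"
    by (intro sum_nonneg less_imp_le prod_diag_over_beta_bar_pos[OF assms]) simp
  then show ?thesis
    by (simp add: alpha_def)
qed

theorem theorem2p7:
  fixes n :: nat and M B :: "real mat"
  assumes "n \<ge> 2"
    and "M \<in> carrier_mat n n"
    and "B_matrix M"
    and "B = B_plus M"
    and "(beta_hat_min B > 1 \<and> alpha B < 1 / beta B) \<or>
         (beta_hat_min B < 1 \<and> alpha B * beta B < beta_hat_min B)"
  shows "(\<Sum>i\<in>{0..<n}. (real n - 1) / min (beta_hat B i) 1 *
            (\<Prod>j\<in>{0..<i}. B $$ (j, j) / beta_bar B j))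
         < (real n - 1) / min (beta B) 1"
proof -
  have dim: "dim_row B = n"
    using assms(2,4) by (simp add: B_plus_def)
  have beta: "beta B > 0"
    using beta_B_plus_pos[of M] assms(1-4) by auto
  define \<mu> where "\<mu> = min (beta_hat_min B) 1"
  have key: "alpha B * beta B < \<mu>"
    using assms(5) beta by (auto simp: \<mu>_def field_simps)
  have "beta B \<le> alpha B * beta B"
    using alpha_ge_1[OF beta] beta by simp
  with key have "beta B < \<mu>"
    by linarith
  then have \<mu>: "\<mu> > 0" and beta1: "min (beta B) 1 = beta B"
    using beta by (auto simp: \<mu>_def)
  have \<mu>_le: "\<mu> \<le> min (beta_hat B i) 1" if "i < n" for i
    using that dim unfolding \<mu>_def beta_hat_min_def by (intro min.mono Min_le) auto
  have "(\<Sum>i\<in>{0..<n}. (real n - 1) / min (beta_hat B i) 1 *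
            (\<Prod>j\<in>{0..<i}. B $$ (j, j) / beta_bar B j))
      \<le> (\<Sum>i\<in>{0..<n}. (real n - 1) / \<mu> * (\<Prod>j\<in>{0..<i}. B $$ (j, j) / beta_bar B j))"
  proof (intro sum_mono mult_right_mono)
    fix i assume "i \<in> {0..<n}"
    then show "(real n - 1) / min (beta_hat B i) 1 \<le> (real n - 1) / \<mu>"
      using \<mu> \<mu>_le[of i] assms(1) by (intro frac_le) auto
    show "0 \<le> (\<Prod>j\<in>{0..<i}. B $$ (j, j) / beta_bar B j)"
      using prod_diag_over_beta_bar_pos[OF beta, of i] \<open>i \<in> {0..<n}\<close> dim by auto
  qed
  also have "\<dots> = (real n - 1) * (alpha B / \<mu>)"
    using alpha_eq_sum_prod[of B] assms(1) dim by (simp add: sum_distrib_left sum_divide_distrib)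
  also have "\<dots> < (real n - 1) * (1 / beta B)"
    using key beta \<mu> assms(1) by (intro mult_strict_left_mono) (auto simp: field_simps)
  finally show ?thesis
    by (simp add: beta1)
qed

end
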